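(* Let $n$ be a positive integer. Then $H_2(F_n;\Gamma_\pi)$ is a free $\mathbb{Z}[H]$-module of rank $n(n-1)/2$.
   Context: Let $F'_n=\{(z_1,z_2)\in\mathbb{C}^2: z_1\ne z_2,\ z_1,z_2\notin\{1,\dots,n\}\}$ and $F_n=F'_n/\Sigma_2$, where $\Sigma_2$ exchanges the two coordinates. $F_n$ is homotopy equivalent to the 2-dimensional CW-complex $Sal(F_n)$ (a quotient, up to collapsing, of a Salvetti complex) with a unique vertex; oriented edges $c_i$ ($1\le i\le n+1$), $a_i,b_i$ ($1\le i\le n$); and 2-cells $A_{ij}$ ($1\le i<j\le n$), $B_{i,r}$ ($1\le i\le n$, $1\le r\le 3$), with boundaries $$\partial A_{ij}=(b_ia_j)(a_jb_i)^{-1},\quad \partial B_{i,1}=(a_ic_{i+1})(c_ia_i)^{-1},\quad \partial B_{i,2}=(c_{i+1}b_i)(c_ia_i)^{-1},\quad \partial B_{i,3}=(c_{i+1}b_i)(b_ic_i)^{-1}.$$ $H_1(F_n)=H_1(Sal(F_n))$ is free abelian with basis $[a_1],\dots,[a_n],[c_1]$. Geometrically $[a_i]$ is the class of one of the two points turning once around $i$, and $[c_1]$ is the class of the half-turn exchange of the two points. Let $H$ be the free abelian group on $\{x,y\}$ and let $\pi:\pi_1(F_n)\to H_1(F_n)\to H$ be the composition of the natural projection with the homomorphism $[a_i]\mapsto x$ ($1\le i\le n$), $[c_1]\mapsto y$. Let $\widetilde{F_n}\to F_n$ be the regular covering with $\pi_1(\widetilde{F_n})=\ker\pi$ and deck group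 $H$. Then $H_*(F_n;\Gamma_\pi)$ denotes the homology $H_*(\widetilde{F_n})$ with its structure of module over $\mathbb{Z}[H]=\mathbb{Z}[x^{\pm1},y^{\pm1}]$. Equivalently, $H_2(F_n;\Gamma_\pi)=\ker d$, where $d: C_2\to C_1$ is the $\mathbb{Z}[H]$-linear map from the free $\mathbb{Z}[H]$-module $C_2$ on the 2-cells to the free $\mathbb{Z}[H]$-module $C_1$ on the edges given by $dA_{ij}=(x-1)(a_j-b_i)$, $dB_{i,1}=(1-y)a_i-c_i+xc_{i+1}$, $dB_{i,2}=-ya_i+yb_i-c_i+c_{i+1}$, $dB_{i,3}=(y-1)b_i-xc_i+c_{i+1}$. *)

theory Defs
  imports Complex_Main "HOL-Library.Poly_Mapping" "HOL-Library.Product_Plus"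
begin

section \<open>The group ring of \<open>H\<close> and its free modules\<close>

text \<open>
  \<open>H\<close> is \<open>int \<times> int\<close>, written additively, with \<open>x = (1, 0)\<close> and \<open>y = (0, 1)\<close>.
  Finitely supported functions \<open>H \<Rightarrow> int\<close> with the convolution product of
  \<^theory>\<open>HOL-Library.Poly_Mapping\<close> are exactly the group ring of \<open>H\<close>, i.e. the ring of Laurent
  polynomials in \<open>x\<close> and \<open>y\<close>.
\<close>

type_synonym deck = "int \<times> int"
type_synonym group_ring = "deck \<Rightarrow>\<^sub>0 int"

abbreviation gr :: "deck \<Rightarrow> group_ring" where "gr h \<equiv> Poly_Mapping.single h 1"

definition gr_x :: group_ring where "gr_x = gr (1, 0)"
definition gr_y :: group_ring where "gr_y = gr (0, 1)"

text \<open>\<open>'c \<Rightarrow>\<^sub>0 'r\<close> is the free \<open>'r\<close>-module on \<open>'c\<close>; \<open>basis c\<close> is the basis element \<open>c\<close>.\<close>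

definition smul :: "'r::comm_ring_1 \<Rightarrow> ('c \<Rightarrow>\<^sub>0 'r) \<Rightarrow> ('c \<Rightarrow>\<^sub>0 'r)" where
  "smul r f = Poly_Mapping.map ((*) r) f"

abbreviation basis :: "'c \<Rightarrow> ('c \<Rightarrow>\<^sub>0 'r::comm_ring_1)" where
  "basis c \<equiv> Poly_Mapping.single c 1"

definition free_on :: "'c set \<Rightarrow> ('c \<Rightarrow>\<^sub>0 'r::comm_ring_1) set" where
  "free_on S = {f. Poly_Mapping.keys f \<subseteq> S}"

text \<open>The finiteness of \<open>B\<close> matters for \<open>r = 0\<close>, as \<open>card\<close> is \<open>0\<close> on infinite sets.\<close>

definition (in module) free_of_rank :: "'b set \<Rightarrow> nat \<Rightarrow> bool" where
  "free_of_rank K r \<longleftrightarrow> (\<exists>B. finite B \<and> card B = r \<and> independent B \<and> span B = K)"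

lemma lookup_smul [simp]: "Poly_Mapping.lookup (smul r f) c = r * Poly_Mapping.lookup f c"
  by (simp add: smul_def Poly_Mapping.map.rep_eq when_def)

interpretation chain: module "smul :: 'r::comm_ring_1 \<Rightarrow> ('c \<Rightarrow>\<^sub>0 'r) \<Rightarrow> ('c \<Rightarrow>\<^sub>0 'r)"
  by standard (auto intro!: poly_mapping_eqI simp: lookup_add algebra_simps)


section \<open>The complex \<open>Sal(F\<^sub>n)\<close>\<close>

text \<open>
  \<open>F\<^sub>n\<close>, the space of unordered pairs of distinct points of the complex plane without \<open>1, \<dots>, n\<close>,
  is homotopy equivalent to this 2-complex, which has one vertex. Homology with coefficients in
  \<open>\<Gamma>\<^sub>\<pi>\<close> is computed below from the cellular chains of its covering with deck group \<open>H\<close>.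
\<close>

datatype edge = Ea nat | Eb nat | Ec nat

datatype face = FA nat nat | FB1 nat | FB2 nat | FB3 nat

definition edges :: "nat \<Rightarrow> edge set" where
  "edges n = Ea ` {1..n} \<union> Eb ` {1..n} \<union> Ec ` {1..n + 1}"

definition faces :: "nat \<Rightarrow> face set" where
  "faces n = {FA i j | i j. 1 \<le> i \<and> i < j \<and> j \<le> n}
     \<union> FB1 ` {1..n} \<union> FB2 ` {1..n} \<union> FB3 ` {1..n}"

text \<open>Edge paths are words in the edges; \<open>(e, False)\<close> is \<open>e\<close> traversed backwards.\<close>

type_synonym path = "(edge \<times> bool) list"

definition word :: "edge list \<Rightarrow> path" where
  "word es = map (\<lambda>e. (e, True)) es"

definition inv_word :: "edge list \<Rightarrow> path" where
  "inv_word es = rev (map (\<lambda>e. (e, False)) es)"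

fun attach :: "face \<Rightarrow> path" where
  "attach (FA i j) = word [Eb i, Ea j] @ inv_word [Ea j, Eb i]"
| "attach (FB1 i) = word [Ea i, Ec (i + 1)] @ inv_word [Ec i, Ea i]"
| "attach (FB2 i) = word [Ec (i + 1), Eb i] @ inv_word [Ec i, Ea i]"
| "attach (FB3 i) = word [Ec (i + 1), Eb i] @ inv_word [Eb i, Ec i]"


section \<open>The covering with deck group \<open>H\<close> and its cellular homology\<close>

text \<open>
  The homomorphism \<open>\<pi>\<close> on the loops given by the edges. Only the values on \<open>a\<^sub>i\<close> and on \<open>c\<^sub>1\<close> are
  prescribed; the lemma \<open>pi_edge_unique\<close> below shows that the 2-cells force the others.
\<close>

fun pi_edge :: "edge \<Rightarrow> deck" where
  "pi_edge (Ea i) = (1, 0)"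
| "pi_edge (Eb i) = (1, 0)"
| "pi_edge (Ec i) = (0, 1)"

definition path_value :: "(edge \<Rightarrow> deck) \<Rightarrow> path \<Rightarrow> deck" where
  "path_value \<phi> w = (\<Sum>(e, s)\<leftarrow>w. if s then \<phi> e else - \<phi> e)"

text \<open>
  \<open>Sal(F\<^sub>n)\<close> has a single vertex, so the vertices of the covering are the elements of \<open>H\<close>. The cells
  over a cell \<open>e\<close> are its translates \<open>gr h \<cdot> e\<close>, whence the cellular chains of the covering are the
  free group-ring modules on the cells of \<open>Sal(F\<^sub>n)\<close>; the lift \<open>gr h \<cdot> e\<close> of an edge runs from \<open>h\<close> to
  \<open>h + pi_edge e\<close>. \<open>lift_path h w\<close> is the 1-chain of the lift of \<open>w\<close> starting at \<open>h\<close>.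
\<close>

fun lift_path :: "deck \<Rightarrow> path \<Rightarrow> (edge \<Rightarrow>\<^sub>0 group_ring)" where
  "lift_path h [] = 0"
| "lift_path h ((e, True) # w) = smul (gr h) (basis e) + lift_path (h + pi_edge e) w"
| "lift_path h ((e, False) # w) =
     - smul (gr (h - pi_edge e)) (basis e) + lift_path (h - pi_edge e) w"

definition boundary2 :: "(face \<Rightarrow>\<^sub>0 group_ring) \<Rightarrow> (edge \<Rightarrow>\<^sub>0 group_ring)" where
  "boundary2 z =
     (\<Sum>s\<in>Poly_Mapping.keys z. smul (Poly_Mapping.lookup z s) (lift_path 0 (attach s)))"

text \<open>There are no 3-cells, so the second homology is the kernel of the boundary map.\<close>

definition H2 :: "nat \<Rightarrow> (face \<Rightarrow>\<^sub>0 group_ring) set" where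
  "H2 n = {z \<in> free_on (faces n). boundary2 z = 0}"


section \<open>Consistency checks\<close>

lemma pi_edge_unique:
  assumes "n \<ge> 1"
  shows "(\<forall>s\<in>faces n. path_value \<phi> (attach s) = 0) \<and> (\<forall>i\<in>{1..n}. \<phi> (Ea i) = (1, 0)) \<and>
           \<phi> (Ec 1) = (0, 1) \<longleftrightarrow>
         (\<forall>e\<in>edges n. \<phi> e = pi_edge e)" (is "?L \<longleftrightarrow> ?R")
proof
  assume L: ?L
  have ca: "\<phi> (Ec (i + 1)) = \<phi> (Ec i)" if "i \<in> {1..n}" for i
  proof -
    have "FB1 i \<in> faces n" using that by (simp add: faces_def)
    with L have "path_value \<phi> (attach (FB1 i)) = 0" by blast
    then show ?thesis by (simp add: path_value_def word_def inv_word_def)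
  qed
  have c: "\<phi> (Ec i) = (0, 1)" if "1 \<le> i" "i \<le> n + 1" for i
    using that
  proof (induction i rule: nat_induct_at_least)
    case base
    then show ?case using L by simp
  next
    case (Suc i)
    then show ?case using ca[of i] by simp
  qed
  have b: "\<phi> (Eb i) = (1, 0)" if "i \<in> {1..n}" for i
  proof -
    have "FB2 i \<in> faces n" using that by (simp add: faces_def)
    with L have "path_value \<phi> (attach (FB2 i)) = 0" by blast
    moreover have "\<phi> (Ea i) = (1, 0)" using L that by blast
    ultimately show ?thesis
      using ca[OF that] by (simp add: path_value_def word_def inv_word_def prod_eq_iff)
  qed
  show ?R using L b c by (auto simp: edges_def)
next
  assume ?R
  then have "\<phi> (Ea i) = (1, 0) \<and> \<phi> (Eb i) = (1, 0)" if "1 \<le> i" "i \<le> n" for i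
    using that by (auto simp: edges_def)
  moreover from \<open>?R\<close> have "\<phi> (Ec i) = (0, 1)" if "1 \<le> i" "i \<le> n + 1" for i
    using that by (auto simp: edges_def)
  ultimately show ?L
    using assms by (auto simp: faces_def path_value_def word_def inv_word_def zero_prod_def)
qed

lemma smul_single: "smul r (basis e) = Poly_Mapping.single e r"
  by (rule poly_mapping_eqI) (simp add: lookup_single when_def)

lemma gr_mult: "gr g * gr h = gr (g + h)"
  by (simp add: mult_single)

lemma boundary2_basis: "boundary2 (basis s) = lift_path 0 (attach s)"
  by (simp add: boundary2_def)

lemma boundary2_faces:
  "boundary2 (basis (FA i j)) = smul (gr_x - 1) (basis (Ea j) - basis (Eb i))"
  "boundary2 (basis (FB1 i)) =
     smul (1 - gr_y) (basis (Ea i)) - basis (Ec i) + smul gr_x (basis (Ec (i + 1)))"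
  "boundary2 (basis (FB2 i)) =
     - smul gr_y (basis (Ea i)) + smul gr_y (basis (Eb i)) - basis (Ec i) + basis (Ec (i + 1))"
  "boundary2 (basis (FB3 i)) =
     smul (gr_y - 1) (basis (Eb i)) - smul gr_x (basis (Ec i)) + basis (Ec (i + 1))"
proof -
  have "gr 0 = 1" by simp
  note s = boundary2_basis word_def inv_word_def gr_x_def gr_y_def chain.scale_left_diff_distrib
    chain.scale_right_diff_distrib zero_prod_def[symmetric] this
  show "boundary2 (basis (FA i j)) = smul (gr_x - 1) (basis (Ea j) - basis (Eb i))"
    by (simp add: s)
  show "boundary2 (basis (FB1 i)) =
      smul (1 - gr_y) (basis (Ea i)) - basis (Ec i) + smul gr_x (basis (Ec (i + 1)))"
    by (simp add: s)
  show "boundary2 (basis (FB2 i)) =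
      - smul gr_y (basis (Ea i)) + smul gr_y (basis (Eb i)) - basis (Ec i) + basis (Ec (i + 1))"
    by (simp add: s)
  show "boundary2 (basis (FB3 i)) =
      smul (gr_y - 1) (basis (Eb i)) - smul gr_x (basis (Ec i)) + basis (Ec (i + 1))"
    by (simp add: s)
qed

lemma boundary2_sum:
  assumes "finite S" "Poly_Mapping.keys z \<subseteq> S"
  shows "boundary2 z = (\<Sum>s\<in>S. smul (Poly_Mapping.lookup z s) (lift_path 0 (attach s)))"
  unfolding boundary2_def
  using assms by (intro sum.mono_neutral_left) (auto simp: in_keys_iff)

lemma module_hom_boundary2: "module_hom smul smul boundary2"
proof unfold_locales
  fix z w :: "face \<Rightarrow>\<^sub>0 group_ring" and r :: group_ring
  let ?S = "Poly_Mapping.keys z \<union> Poly_Mapping.keys w"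
  have fin: "finite ?S" by simp
  have "boundary2 (z + w) =
      (\<Sum>s\<in>?S. smul (Poly_Mapping.lookup (z + w) s) (lift_path 0 (attach s)))"
    by (rule boundary2_sum[OF fin keys_add])
  also have "\<dots> = boundary2 z + boundary2 w"
    by (simp add: boundary2_sum[OF fin] lookup_add chain.scale_left_distrib sum.distrib)
  finally show "boundary2 (z + w) = boundary2 z + boundary2 w" .
  have "Poly_Mapping.keys (smul r z) \<subseteq> Poly_Mapping.keys z"
    by (auto simp: in_keys_iff)
  then have "boundary2 (smul r z) =
      (\<Sum>s\<in>Poly_Mapping.keys z. smul (Poly_Mapping.lookup (smul r z) s) (lift_path 0 (attach s)))"
    by (intro boundary2_sum) simp_all
  also have "\<dots> = smul r (boundary2 z)"
    by (simp add: boundary2_def chain.scale_sum_right)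
  finally show "boundary2 (smul r z) = smul r (boundary2 z)" .
qed

lemma free_on_iff: "f \<in> free_on S \<longleftrightarrow> (\<forall>k. k \<notin> S \<longrightarrow> Poly_Mapping.lookup f k = 0)"
  by (auto simp: free_on_def in_keys_iff)

lemma subspace_free_on: "chain.subspace (free_on S)"
  by (simp add: chain.subspace_def free_on_iff lookup_add)

lemma lift_path_in_free_on: "fst ` set w \<subseteq> S \<Longrightarrow> lift_path h w \<in> free_on S"
  by (induction h w rule: lift_path.induct)
    (auto simp: free_on_iff lookup_add lookup_minus lookup_single when_def)

lemma boundary2_in_free_on:
  assumes "z \<in> free_on (faces n)"
  shows "boundary2 z \<in> free_on (edges n)"
proof -
  have "lift_path 0 (attach s) \<in> free_on (edges n)" if "s \<in> faces n" for s
    using that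
    by (intro lift_path_in_free_on) (auto simp: faces_def edges_def word_def inv_word_def)
  then show ?thesis
    using assms unfolding boundary2_def
    by (intro chain.subspace_sum chain.subspace_scale subspace_free_on) (auto simp: free_on_def)
qed

lemma subspace_H2: "chain.subspace (H2 n)"
proof -
  interpret module_hom smul smul boundary2 by (rule module_hom_boundary2)
  show ?thesis
    using subspace_free_on[of "faces n"]
    by (auto simp: chain.subspace_def H2_def add zero scale)
qed

end

theory Submission
  imports Defs
begin

text \<open>
  Write a chain as \<open>z = \<Sum> a\<^sub>i\<^sub>j A\<^sub>i\<^sub>j + \<Sum> (p\<^sub>k B\<^sub>k\<^sub>1 + q\<^sub>k B\<^sub>k\<^sub>2 + r\<^sub>k B\<^sub>k\<^sub>3)\<close>, and let
  \<open>S\<^sub>k = \<Sum>\<^bsub>i<k\<^esub> a\<^sub>i\<^sub>k\<close> and \<open>T\<^sub>k = \<Sum>\<^bsub>j>k\<^esub> a\<^sub>k\<^sub>j\<close> be its column and row sums. The boundary vanishes at the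
  edges \<open>a\<^sub>k\<close> and \<open>b\<^sub>k\<close> iff \<open>(x - 1) S\<^sub>k = y q\<^sub>k - (1 - y) p\<^sub>k\<close> and
  \<open>(x - 1) T\<^sub>k = y q\<^sub>k + (y - 1) r\<^sub>k\<close>; at the edges \<open>c\<^sub>k\<close> it gives a telescoping recursion. Subtracting the
  first two equations, \<open>x - 1\<close> divides \<open>(y - 1) (r\<^sub>k - p\<^sub>k)\<close>, hence \<open>r\<^sub>k - p\<^sub>k = (x - 1) w\<^sub>k\<close>. The recursion
  then evaluates \<open>p\<^sub>k + q\<^sub>k + x r\<^sub>k\<close> to \<open>- (x - 1)\<^sup>2 \<Sum>\<^bsub>i<k\<^esub> w\<^sub>i\<close>, and closes up at \<open>c\<^bsub>n+1\<^esub>\<close> iff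
  \<open>\<Sum> w\<^sub>i = 0\<close>. Eliminating \<open>q\<^sub>k\<close> shows that \<open>x - 1\<close> divides \<open>(1 + xy) p\<^sub>k\<close>, hence
  \<open>p\<^sub>k = - (x - 1) s\<^sub>k\<close>. So \<open>p\<close>, \<open>q\<close>, \<open>r\<close> are expressed by \<open>s\<close> and \<open>w\<close>, and cancelling \<open>x - 1\<close> leaves
  \<open>S\<^sub>k = (1 + xy) s\<^sub>k - xy w\<^sub>k - y (x - 1) \<Sum>\<^bsub>i<k\<^esub> w\<^sub>i\<close> and \<open>T\<^sub>k = S\<^sub>k + (y - 1) w\<^sub>k\<close>
  (\<open>H2_has_parameters\<close>, \<open>parameters_imp_H2\<close>).

  These equations can be solved freely. As \<open>S\<^sub>1\<close> and \<open>T\<^sub>n\<close> are empty sums and \<open>xy\<close> is a unit, \<open>w\<^sub>1\<close> is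
  determined by \<open>s\<^sub>1\<close> and \<open>w\<^sub>n\<close> by \<open>s\<^sub>n\<close>. For \<open>n \<ge> 3\<close>, the relation \<open>\<Sum> w\<^sub>i = 0\<close> then determines
  \<open>w\<^bsub>n-1\<^esub>\<close>, and any \<open>s\<^sub>1, \<dots>, s\<^sub>n, w\<^sub>2, \<dots>, w\<^bsub>n-2\<^esub>\<close> are possible. Given \<open>s\<close> and \<open>w\<close>, the \<open>a\<^sub>i\<^sub>j\<close> are a
  strictly triangular array with prescribed row and column sums: its entries with \<open>2 \<le> i < j < n\<close>
  are arbitrary and determine its first row and last column (\<open>balanced_extension\<close>,
  \<open>balanced_zero\<close>). This makes \<open>n + (n - 3) + (n - 2) (n - 3) / 2 = n (n - 1) / 2\<close> free coordinates
  (\<open>free_of_rank_coordinates\<close>). For \<open>n = 2\<close> the relation \<open>\<Sum> w\<^sub>i = 0\<close> determines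
  \<open>s\<^sub>2\<close> by \<open>s\<^sub>1\<close> instead, because \<open>1 + xy\<close> can be cancelled, and for \<open>n = 1\<close> it forces \<open>w\<^sub>1 = 0\<close> and
  \<open>s\<^sub>1 = 0\<close>.
\<close>

section \<open>Regular elements and divisibility by \<open>x - 1\<close>\<close>

lemma poly_mapping_induct_sum [case_names single sum]:
  fixes f :: "'a \<Rightarrow>\<^sub>0 'b::comm_monoid_add"
  assumes single: "\<And>k v. P (Poly_Mapping.single k v)"
    and sum: "\<And>f g. P f \<Longrightarrow> P g \<Longrightarrow> P (f + g)"
  shows "P f"
proof (induction f rule: update_induct)
  case const
  show ?case using single[of _ 0] by simp
next
  case (update f a b)
  have "Poly_Mapping.update a b f = Poly_Mapping.single a b + f"
    using update(1)
    by (intro poly_mapping_eqI)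
      (auto simp: lookup_update lookup_add lookup_single when_def in_keys_iff)
  then show ?case using single sum update(3) by metis
qed

lemma lookup_gr_mult:
  fixes f :: group_ring
  shows "Poly_Mapping.lookup (gr g * f) h = Poly_Mapping.lookup f (h - g)"
proof (induction f rule: poly_mapping_induct_sum)
  case (single k v)
  show ?case by (auto simp: mult_single lookup_single when_def)
next
  case (sum f f')
  then show ?case by (simp add: distrib_left lookup_add)
qed

text \<open>
  The support of such an \<open>f\<close> is stable under translation by \<open>g\<close>; being finite, it is empty. With
  \<open>g = x, y, xy\<close> this gives the regularity of \<open>x - 1\<close>, \<open>y \<plusminus> 1\<close> and \<open>1 + xy\<close>.
\<close>

lemma no_translation_eigenvector:
  fixes f :: group_ring
  assumes "g \<noteq> 0" "gr g * f = f \<or> gr g * f = - f"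
  shows "f = 0"
proof (rule ccontr)
  assume "f \<noteq> 0"
  \<comment> \<open>\<open>\<mu>\<close> is the scalar product with \<open>g\<close>, which every translation by \<open>g\<close> increases.\<close>
  define \<mu> where "\<mu> h = fst h * fst g + snd h * snd g" for h :: deck
  have "fst g * fst g + snd g * snd g > 0"
    using \<open>g \<noteq> 0\<close> by (auto simp: prod_eq_iff sum_squares_gt_zero_iff)
  then have step: "\<mu> (h + g) > \<mu> h" for h
    by (simp add: \<mu>_def algebra_simps)
  have ne: "Poly_Mapping.keys f \<noteq> {}"
    using \<open>f \<noteq> 0\<close> by simp
  have "Max (\<mu> ` Poly_Mapping.keys f) \<in> \<mu> ` Poly_Mapping.keys f"
    by (rule Max_in) (use ne in simp_all)
  then obtain h where h: "h \<in> Poly_Mapping.keys f" "\<mu> h = Max (\<mu> ` Poly_Mapping.keys f)"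
    by (metis imageE)
  have "Poly_Mapping.lookup (gr g * f) (h + g) \<noteq> 0"
    using h(1) by (simp add: lookup_gr_mult in_keys_iff)
  then have "h + g \<in> Poly_Mapping.keys f"
    using assms(2) by (auto simp: in_keys_iff)
  then have "\<mu> (h + g) \<le> \<mu> h"
    using h(2) by simp
  with step[of h] show False by simp
qed

lemma x_minus_1_regular: "(gr_x - 1) * f = 0 \<Longrightarrow> f = 0"
  using no_translation_eigenvector[of "(1, 0)" f]
  by (simp add: gr_x_def left_diff_distrib zero_prod_def)

lemma y_minus_1_regular: "(gr_y - 1) * f = 0 \<Longrightarrow> f = 0"
  using no_translation_eigenvector[of "(0, 1)" f]
  by (simp add: gr_y_def left_diff_distrib zero_prod_def)

lemma y_plus_1_regular: "(1 + gr_y) * f = 0 \<Longrightarrow> f = 0"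
  using no_translation_eigenvector[of "(0, 1)" f]
  by (simp add: gr_y_def distrib_right zero_prod_def eq_neg_iff_add_eq_0 add.commute)

lemma xy_plus_1_regular: "(1 + gr_x * gr_y) * f = 0 \<Longrightarrow> f = 0"
  using no_translation_eigenvector[of "(1, 1)" f]
  by (simp add: gr_x_def gr_y_def mult_single distrib_right zero_prod_def eq_neg_iff_add_eq_0
      add.commute)

lemma x_minus_1_cancel: "(gr_x - 1) * f = (gr_x - 1) * g \<longleftrightarrow> f = g"
  using x_minus_1_regular[of "f - g"] by (auto simp: right_diff_distrib)

text \<open>
  The Laurent polynomials in \<open>y\<close> alone represent the residue ring modulo \<open>x - 1\<close>: every class
  contains exactly one of them (\<open>congruent_to_laurent_y\<close>, \<open>laurent_y_dvd_imp_zero\<close>).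
\<close>

definition laurent_y :: "group_ring set" where
  "laurent_y = free_on {h. fst h = 0}"

lemma laurent_y_iff: "f \<in> laurent_y \<longleftrightarrow> (\<forall>h. fst h \<noteq> 0 \<longrightarrow> Poly_Mapping.lookup f h = 0)"
  by (simp add: laurent_y_def free_on_iff)

lemma x_minus_1_dvd_gr: "gr_x - 1 dvd gr (i, 0) - 1"
proof (induction i rule: int_induct[of _ 0])
  case base
  show ?case by (simp add: zero_prod_def[symmetric])
next
  case (step1 i)
  have "gr (i + 1, 0) - 1 = gr_x * (gr (i, 0) - 1) + (gr_x - 1)"
    by (simp add: gr_x_def right_diff_distrib mult_single add.commute)
  then show ?case using step1 by (metis dvd_add dvd_mult dvd_refl)
next
  case (step2 i)
  have "gr (i, 0) - 1 - (gr_x - 1) * gr (i - 1, 0) = gr (i - 1, 0) - 1"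
    by (simp add: gr_x_def left_diff_distrib mult_single)
  then show ?case using step2 by (metis dvd_diff dvd_triv_left)
qed

lemma congruent_to_laurent_y: "\<exists>g\<in>laurent_y. gr_x - 1 dvd f - g"
proof (induction f rule: poly_mapping_induct_sum)
  case (single h c)
  have "Poly_Mapping.single h c - Poly_Mapping.single (0, snd h) c
      = (gr (fst h, 0) - 1) * Poly_Mapping.single (0, snd h) c"
    by (simp add: left_diff_distrib mult_single)
  then have "gr_x - 1 dvd Poly_Mapping.single h c - Poly_Mapping.single (0, snd h) c"
    by (simp add: x_minus_1_dvd_gr)
  moreover have "Poly_Mapping.single (0, snd h) c \<in> laurent_y"
    by (auto simp: laurent_y_iff lookup_single when_def)
  ultimately show ?case by blast
next
  case (sum f f')
  then obtain g g' where "g \<in> laurent_y" "gr_x - 1 dvd f - g"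
    "g' \<in> laurent_y" "gr_x - 1 dvd f' - g'" by blast
  then have "g + g' \<in> laurent_y" "gr_x - 1 dvd (f + f') - (g + g')"
    by (auto simp: laurent_y_iff lookup_add add_diff_add)
  then show ?case by blast
qed

text \<open>
  If \<open>g \<noteq> 0\<close>, then the extreme powers of \<open>x\<close> in \<open>g\<close> do not cancel in \<open>(x - 1) g\<close>, which therefore has
  terms with two different powers of \<open>x\<close>.
\<close>

lemma laurent_y_dvd_imp_zero:
  assumes "f \<in> laurent_y" "gr_x - 1 dvd f"
  shows "f = 0"
proof (rule ccontr)
  assume "f \<noteq> 0"
  obtain g where g: "f = (gr_x - 1) * g" using assms(2) by blast
  with \<open>f \<noteq> 0\<close> have ne: "Poly_Mapping.keys g \<noteq> {}" by auto
  have coeff: "Poly_Mapping.lookup f h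
      = Poly_Mapping.lookup g (h - (1, 0)) - Poly_Mapping.lookup g h" for h
    by (simp add: g gr_x_def left_diff_distrib lookup_minus lookup_gr_mult)
  let ?D = "fst ` Poly_Mapping.keys g"
  have D: "finite ?D" "?D \<noteq> {}" using ne by simp_all
  obtain h where h: "h \<in> Poly_Mapping.keys g" "fst h = Max ?D"
    using Max_in[OF D] by (metis imageE)
  obtain l where l: "l \<in> Poly_Mapping.keys g" "fst l = Min ?D"
    using Min_in[OF D] by (metis imageE)
  \<comment> \<open>The top power of \<open>x\<close> in \<open>(x - 1) g\<close> is one above that in \<open>g\<close>.\<close>
  have "h + (1, 0) \<notin> Poly_Mapping.keys g"
    using Max_ge[OF D(1), of "fst (h + (1, 0))"] h(2) by force
  with coeff[of "h + (1, 0)"] h(1) have "Poly_Mapping.lookup f (h + (1, 0)) \<noteq> 0"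
    by (simp add: in_keys_iff)
  with assms(1) have "fst (h + (1, 0)) = 0" unfolding laurent_y_iff by blast
  then have "fst h + 1 = 0" by simp
  \<comment> \<open>The lowest powers of \<open>x\<close> in \<open>(x - 1) g\<close> and in \<open>g\<close> agree.\<close>
  have "l - (1, 0) \<notin> Poly_Mapping.keys g"
    using Min_le[OF D(1), of "fst (l - (1, 0))"] l(2) by force
  with coeff[of l] l(1) have "Poly_Mapping.lookup f l \<noteq> 0"
    by (simp add: in_keys_iff)
  with assms(1) have "fst l = 0" unfolding laurent_y_iff by blast
  moreover have "fst l \<le> fst h"
    using l(2) h(1) D(1) by simp
  ultimately show False using \<open>fst h + 1 = 0\<close> by simp
qed

lemma laurent_y_mult_y: "f \<in> laurent_y \<Longrightarrow> gr_y * f \<in> laurent_y"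
  by (simp add: laurent_y_iff gr_y_def lookup_gr_mult)

text \<open>
  Multiplication by \<open>u\<close> respects the representatives in \<open>laurent_y\<close> and is injective on them, so it is
  injective modulo \<open>x - 1\<close>.
\<close>

lemma x_minus_1_dvd_cancel:
  assumes "gr_x - 1 dvd u * f"
    and "\<And>g. g \<in> laurent_y \<Longrightarrow> u * g \<in> laurent_y"
    and "\<And>g. u * g = 0 \<Longrightarrow> g = 0"
  shows "gr_x - 1 dvd f"
proof -
  obtain g where g: "g \<in> laurent_y" "gr_x - 1 dvd f - g"
    using congruent_to_laurent_y by blast
  have "u * g = u * f - u * (f - g)" by (simp add: right_diff_distrib)
  moreover have "gr_x - 1 dvd u * f - u * (f - g)"
    by (rule dvd_diff[OF assms(1) dvd_mult[OF g(2)]])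
  ultimately have "gr_x - 1 dvd u * g" by (rule ssubst)
  then have "u * g = 0"
    by (rule laurent_y_dvd_imp_zero[OF assms(2)[OF g(1)]])
  then have "g = 0" by (rule assms(3))
  with g(2) show ?thesis by simp
qed

lemma x_minus_1_dvd_cancel_y_minus_1:
  assumes "gr_x - 1 dvd (gr_y - 1) * f"
  shows "gr_x - 1 dvd f"
  using assms
proof (rule x_minus_1_dvd_cancel)
  show "(gr_y - 1) * g \<in> laurent_y" if "g \<in> laurent_y" for g
    using laurent_y_mult_y[OF that] that
    by (simp add: laurent_y_iff left_diff_distrib lookup_minus)
qed (rule y_minus_1_regular)

text \<open>
  Modulo \<open>x - 1\<close>, the factor \<open>1 + xy\<close> is \<open>1 + y\<close>.
\<close>

lemma x_minus_1_dvd_cancel_xy_plus_1: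
  assumes "gr_x - 1 dvd (1 + gr_x * gr_y) * f"
  shows "gr_x - 1 dvd f"
proof (rule x_minus_1_dvd_cancel)
  have "(1 + gr_y) * f = (1 + gr_x * gr_y) * f - (gr_x - 1) * (gr_y * f)"
    by (simp add: algebra_simps)
  with assms show "gr_x - 1 dvd (1 + gr_y) * f" by simp
  show "(1 + gr_y) * g \<in> laurent_y" if "g \<in> laurent_y" for g
    using laurent_y_mult_y[OF that] that
    by (simp add: laurent_y_iff distrib_right lookup_add)
qed (rule y_plus_1_regular)

section \<open>Free modules from coordinates\<close>

text \<open>
  The maps \<open>\<xi> i\<close> need to be linear on \<open>K\<close> only, as coordinates obtained by a division make no
  sense elsewhere. The basis consists of the elements whose coordinates are the unit vectors.
\<close>

lemma (in module) free_of_rank_coordinates: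
  assumes "finite I" "subspace K"
    and add: "\<And>i u v. i \<in> I \<Longrightarrow> u \<in> K \<Longrightarrow> v \<in> K \<Longrightarrow> \<xi> i (u + v) = \<xi> i u + \<xi> i v"
    and scale: "\<And>i c v. i \<in> I \<Longrightarrow> v \<in> K \<Longrightarrow> \<xi> i (scale c v) = c * \<xi> i v"
    and inj: "\<And>v. v \<in> K \<Longrightarrow> (\<And>i. i \<in> I \<Longrightarrow> \<xi> i v = 0) \<Longrightarrow> v = 0"
    and surj: "\<And>c. \<exists>v\<in>K. \<forall>i\<in>I. \<xi> i v = c i"
  shows "free_of_rank K (card I)"
proof -
  have "\<exists>v\<in>K. \<forall>i\<in>I. \<xi> i v = (if i = j then 1 else 0)" for j
    by (rule surj)
  then obtain v where v: "\<And>j. v j \<in> K" "\<And>i j. i \<in> I \<Longrightarrow> \<xi> i (v j) = (if i = j then 1 else 0)"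
    by metis
  have zero: "\<xi> i 0 = 0" if "i \<in> I" for i
    using scale[OF that, of 0 0] subspace_0[OF \<open>subspace K\<close>] by simp
  have sum: "\<xi> i (\<Sum>j\<in>J. scale (c j) (v j)) = (\<Sum>j\<in>J. c j * \<xi> i (v j))"
    if "i \<in> I" "finite J" for i J c
    using that(2)
  proof (induction J rule: finite_induct)
    case (insert j J)
    then show ?case
      using that(1) \<open>subspace K\<close> v(1)
      by (simp add: add scale subspace_sum subspace_scale)
  qed (simp add: zero that(1))
  have coord: "\<xi> i (\<Sum>j\<in>J. scale (c j) (v j)) = c i" if "i \<in> J" "J \<subseteq> I" for i J c
  proof -
    have "finite J" "i \<in> I" using that \<open>finite I\<close> finite_subset by auto
    then show ?thesis
      using \<open>i \<in> J\<close> by (simp add: sum v(2) if_distrib cong: if_cong)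
  qed
  have inj_v: "inj_on v I"
    by (rule inj_onI) (metis v(2) zero_neq_one)
  have "finite (v ` I) \<and> card (v ` I) = card I \<and> independent (v ` I) \<and> span (v ` I) = K"
  proof (intro conjI)
    show "card (v ` I) = card I" by (rule card_image[OF inj_v])
    show "independent (v ` I)"
      unfolding independent_explicit_module
    proof (intro allI impI)
      fix t f x assume "finite t" "t \<subseteq> v ` I" and 0: "(\<Sum>x\<in>t. scale (f x) x) = 0" and "x \<in> t"
      then obtain J where J: "J \<subseteq> I" "t = v ` J" by (meson subset_imageE)
      with \<open>x \<in> t\<close> obtain i where i: "i \<in> J" "x = v i" by blast
      have "(\<Sum>j\<in>J. scale (f (v j)) (v j)) = 0"
        using 0 J by (simp add: sum.reindex[OF inj_on_subset[OF inj_v]])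
      then show "f x = 0" using coord[OF i(1) J(1), of "f \<circ> v"] i J by (auto simp: zero)
    qed
    show "span (v ` I) = K"
    proof
      show "span (v ` I) \<subseteq> K" using v(1) \<open>subspace K\<close> by (intro span_minimal) auto
      show "K \<subseteq> span (v ` I)"
      proof
        fix u assume u: "u \<in> K"
        let ?s = "\<Sum>j\<in>I. scale (\<xi> j u) (v j)"
        have s: "?s \<in> K" using v(1) \<open>subspace K\<close> by (intro subspace_sum subspace_scale)
        have "u + scale (- 1) ?s = 0"
        proof (rule inj)
          show "u + scale (- 1) ?s \<in> K"
            using u s \<open>subspace K\<close> by (intro subspace_add subspace_scale)
          show "\<xi> i (u + scale (- 1) ?s) = 0" if "i \<in> I" for i
            using that u s subspace_scale[OF \<open>subspace K\<close> s]
            by (simp only: add scale coord[OF _ subset_refl]) simp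
        qed
        then have "u = ?s" by simp
        also have "\<dots> \<in> span (v ` I)" by (intro span_sum span_scale span_base) simp
        finally show "u \<in> span (v ` I)" .
      qed
    qed
  qed (use \<open>finite I\<close> in simp)
  then show ?thesis
    unfolding free_of_rank_def by blast
qed

section \<open>The equations of a 2-cycle\<close>

lemma sum_faces:
  fixes f :: "face \<Rightarrow> 'm::comm_monoid_add"
  shows "(\<Sum>s\<in>faces n. f s) = (\<Sum>j=1..n. \<Sum>i=1..<j. f (FA i j))
     + (\<Sum>k=1..n. f (FB1 k)) + (\<Sum>k=1..n. f (FB2 k)) + (\<Sum>k=1..n. f (FB3 k))"
proof -
  let ?P = "SIGMA j:{1..n}. {1..<j}"
  let ?A = "(\<lambda>(j, i). FA i j) ` ?P"
  have "faces n = ?A \<union> FB1 ` {1..n} \<union> FB2 ` {1..n} \<union> FB3 ` {1..n}"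
    by (force simp: faces_def)
  moreover have "finite ?A" by simp
  moreover have "?A \<inter> FB1 ` {1..n} = {}" "(?A \<union> FB1 ` {1..n}) \<inter> FB2 ` {1..n} = {}"
    "(?A \<union> FB1 ` {1..n} \<union> FB2 ` {1..n}) \<inter> FB3 ` {1..n} = {}"
    by auto
  ultimately have "(\<Sum>s\<in>faces n. f s)
      = sum f ?A + sum f (FB1 ` {1..n}) + sum f (FB2 ` {1..n}) + sum f (FB3 ` {1..n})"
    by (simp add: sum.union_disjoint del: One_nat_def)
  also have "sum f ?A = (\<Sum>j=1..n. \<Sum>i=1..<j. f (FA i j))"
    by (subst sum.reindex) (auto simp: inj_on_def sum.Sigma case_prod_unfold)
  finally show ?thesis
    by (simp add: sum.reindex inj_on_def)
qed

lemma sum_columns_eq_sum_rows: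
  fixes f :: "nat \<Rightarrow> nat \<Rightarrow> 'm::comm_monoid_add"
  shows "(\<Sum>j=1..n. \<Sum>i=1..<j. f i j) = (\<Sum>i=1..n. \<Sum>j\<in>{i<..n}. f i j)"
  unfolding sum.Sigma[OF finite_atLeastAtMost ballI[OF finite_atLeastLessThan]]
    sum.Sigma[OF finite_atLeastAtMost ballI[OF finite_greaterThanAtMost]]
  by (rule sum.reindex_bij_witness[of _ prod.swap prod.swap]) auto


lemma finite_faces: "finite (faces n)"
  by (rule finite_subset[of _ "case_prod FA ` ({1..n} \<times> {1..n}) \<union> FB1 ` {1..n} \<union> FB2 ` {1..n}
    \<union> FB3 ` {1..n}"]) (auto simp: faces_def)

text \<open>
  By these zeros, the boundary at an edge \<open>c\<^sub>k\<close> is given by one formula for all \<open>k\<close> from \<open>1\<close> to \<open>n + 1\<close>,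
  although \<open>c\<^sub>1\<close> and \<open>c\<^bsub>n+1\<^esub>\<close> meet the cells of one index \<open>k\<close> only.
\<close>

lemma lookup_outside_faces:
  assumes "z \<in> free_on (faces n)" "l \<notin> {1..n}"
  shows "Poly_Mapping.lookup z (FB1 l) = 0" "Poly_Mapping.lookup z (FB2 l) = 0"
    "Poly_Mapping.lookup z (FB3 l) = 0"
proof -
  have "FB1 l \<notin> faces n" "FB2 l \<notin> faces n" "FB3 l \<notin> faces n"
    using assms(2) by (auto simp: faces_def)
  with assms(1) show "Poly_Mapping.lookup z (FB1 l) = 0" "Poly_Mapping.lookup z (FB2 l) = 0"
    "Poly_Mapping.lookup z (FB3 l) = 0"
    by (simp_all add: free_on_iff)
qed

lemma lookup_boundary2:
  assumes "z \<in> free_on (faces n)"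
  defines "c \<equiv> Poly_Mapping.lookup z"
  shows "k \<in> {1..n} \<Longrightarrow> Poly_Mapping.lookup (boundary2 z) (Ea k)
      = (gr_x - 1) * (\<Sum>i=1..<k. c (FA i k)) + (1 - gr_y) * c (FB1 k) - gr_y * c (FB2 k)"
      (is "_ \<Longrightarrow> ?A")
    and "k \<in> {1..n} \<Longrightarrow> Poly_Mapping.lookup (boundary2 z) (Eb k)
      = - (gr_x - 1) * (\<Sum>j\<in>{k<..n}. c (FA k j)) + gr_y * c (FB2 k) + (gr_y - 1) * c (FB3 k)"
      (is "_ \<Longrightarrow> ?B")
    and "k \<le> n \<Longrightarrow> Poly_Mapping.lookup (boundary2 z) (Ec (Suc k))
      = gr_x * c (FB1 k) + c (FB2 k) + c (FB3 k)
        - (c (FB1 (Suc k)) + c (FB2 (Suc k)) + gr_x * c (FB3 (Suc k)))"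
      (is "_ \<Longrightarrow> ?C")
proof -
  have expand: "Poly_Mapping.lookup (boundary2 z) e
      = (\<Sum>s\<in>faces n. c s * Poly_Mapping.lookup (boundary2 (basis s)) e)" for e
    using boundary2_sum[OF finite_faces, of z] assms(1)
    by (simp add: lookup_sum boundary2_basis free_on_def c_def)
  have const_if: "(\<Sum>i\<in>I. if b then f i else 0) = (if b then sum f I else 0)"
    for I :: "nat set" and b and f :: "nat \<Rightarrow> group_ring"
    by simp
  note lookups = boundary2_faces lookup_add lookup_minus lookup_single when_def
    if_distrib[of "(*) _"] if_distrib[of uminus] const_if
  show ?A if "k \<in> {1..n}"
  proof -
    have "Poly_Mapping.lookup (boundary2 z) (Ea k)
        = (\<Sum>i=1..<k. c (FA i k) * (gr_x - 1)) + c (FB1 k) * (1 - gr_y) + c (FB2 k) * (- gr_y)"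
      unfolding expand sum_faces using that by (simp add: lookups cong: if_cong)
    then show ?thesis by (simp add: sum_distrib_left mult.commute)
  qed
  show ?B if "k \<in> {1..n}"
  proof -
    have "Poly_Mapping.lookup (boundary2 z) (Eb k)
        = (\<Sum>j\<in>{k<..n}. c (FA k j) * (- (gr_x - 1))) + c (FB2 k) * gr_y + c (FB3 k) * (gr_y - 1)"
      unfolding expand sum_faces sum_columns_eq_sum_rows using that by (simp add: lookups cong: if_cong)
    then show ?thesis by (simp add: sum_distrib_left sum_negf[symmetric] algebra_simps)
  qed
  have outside: "c (FB1 l) = 0" "c (FB2 l) = 0" "c (FB3 l) = 0" if "l \<notin> {1..n}" for l
    using lookup_outside_faces[OF assms(1) that] by (simp_all add: c_def)
  show ?C if "k \<le> n"
  proof -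
    have "Poly_Mapping.lookup (boundary2 z) (Ec (Suc k))
        = c (FB1 k) * gr_x - c (FB1 (Suc k)) + (c (FB2 k) - c (FB2 (Suc k)))
          + (c (FB3 k) - c (FB3 (Suc k)) * gr_x)"
      unfolding expand sum_faces using that outside[of k] outside[of "Suc k"]
      by (simp add: lookups right_diff_distrib distrib_left sum.distrib sum_subtractf cong: if_cong)
    then show ?thesis by (simp add: algebra_simps)
  qed
qed

section \<open>Parameters of a 2-cycle\<close>

text \<open>
  Meaningful for multiples of \<open>x - 1\<close>, whose quotient is unique as \<open>x - 1\<close> is regular.
\<close>

definition quotient_x_minus_1 :: "group_ring \<Rightarrow> group_ring" where
  "quotient_x_minus_1 f = (THE g. f = (gr_x - 1) * g)"

lemma quotient_x_minus_1_mult [simp]: "quotient_x_minus_1 ((gr_x - 1) * g) = g"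
  unfolding quotient_x_minus_1_def using x_minus_1_cancel by (intro the_equality) auto

text \<open>
  The value that the parameters \<open>s\<close> and \<open>w\<close> of a cycle force on the sum of its coefficients at the
  cells \<open>A\<^sub>i\<^sub>k\<close> with \<open>i < k\<close>.
\<close>

definition column_sum :: "(nat \<Rightarrow> group_ring) \<Rightarrow> (nat \<Rightarrow> group_ring) \<Rightarrow> nat \<Rightarrow> group_ring" where
  "column_sum s w k =
     (1 + gr_x * gr_y) * s k - gr_x * gr_y * w k - gr_y * (gr_x - 1) * (\<Sum>i=1..<k. w i)"

definition balanced ::
  "nat \<Rightarrow> (nat \<Rightarrow> group_ring) \<Rightarrow> (nat \<Rightarrow> group_ring) \<Rightarrow> (nat \<Rightarrow> nat \<Rightarrow> group_ring) \<Rightarrow> bool" where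
  "balanced n s w a \<longleftrightarrow> (\<Sum>i=1..n. w i) = 0 \<and>
     (\<forall>k\<in>{1..n}. (\<Sum>i=1..<k. a i k) = column_sum s w k \<and>
                 (\<Sum>j\<in>{k<..n}. a k j) = column_sum s w k + (gr_y - 1) * w k)"

text \<open>
  The coefficient of \<open>B\<^sub>k\<^sub>2\<close> is the one that makes \<open>p\<^sub>k + q\<^sub>k + x r\<^sub>k\<close> equal to
  \<open>- (x - 1)\<^sup>2 \<Sum>\<^bsub>i<k\<^esub> w\<^sub>i\<close>.
\<close>

definition cycle_parameters ::
  "nat \<Rightarrow> (face \<Rightarrow>\<^sub>0 group_ring) \<Rightarrow> (nat \<Rightarrow> group_ring) \<Rightarrow> (nat \<Rightarrow> group_ring) \<Rightarrow> bool" where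
  "cycle_parameters n z s w \<longleftrightarrow> balanced n s w (\<lambda>i j. Poly_Mapping.lookup z (FA i j)) \<and>
     (\<forall>k\<in>{1..n}. Poly_Mapping.lookup z (FB1 k) = - (gr_x - 1) * s k \<and>
        Poly_Mapping.lookup z (FB2 k) =
          (gr_x - 1) * ((1 + gr_x) * s k - gr_x * w k - (gr_x - 1) * (\<Sum>i=1..<k. w i)) \<and>
        Poly_Mapping.lookup z (FB3 k) = (gr_x - 1) * (w k - s k))"

lemma H2_iff:
  assumes z: "z \<in> free_on (faces n)"
  defines "c \<equiv> Poly_Mapping.lookup z"
  shows "z \<in> H2 n \<longleftrightarrow>
    (\<forall>k\<in>{1..n}.
       (gr_x - 1) * (\<Sum>i=1..<k. c (FA i k)) + (1 - gr_y) * c (FB1 k) - gr_y * c (FB2 k) = 0 \<and>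
       - (gr_x - 1) * (\<Sum>j\<in>{k<..n}. c (FA k j)) + gr_y * c (FB2 k) + (gr_y - 1) * c (FB3 k) = 0)
    \<and> (\<forall>k\<le>n. gr_x * c (FB1 k) + c (FB2 k) + c (FB3 k)
          - (c (FB1 (Suc k)) + c (FB2 (Suc k)) + gr_x * c (FB3 (Suc k))) = 0)"
proof -
  have "z \<in> H2 n \<longleftrightarrow> (\<forall>e\<in>edges n. Poly_Mapping.lookup (boundary2 z) e = 0)"
  proof
    assume "\<forall>e\<in>edges n. Poly_Mapping.lookup (boundary2 z) e = 0"
    then have "Poly_Mapping.lookup (boundary2 z) e = 0" for e
      using boundary2_in_free_on[OF z] by (cases "e \<in> edges n") (auto simp: free_on_iff)
    then have "boundary2 z = 0" by (intro poly_mapping_eqI) (simp only: lookup_zero)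
    then show "z \<in> H2 n" using z by (simp add: H2_def)
  qed (simp add: H2_def)
  also have "\<dots> \<longleftrightarrow> (\<forall>k\<in>{1..n}. Poly_Mapping.lookup (boundary2 z) (Ea k) = 0 \<and>
      Poly_Mapping.lookup (boundary2 z) (Eb k) = 0) \<and>
      (\<forall>k\<le>n. Poly_Mapping.lookup (boundary2 z) (Ec (Suc k)) = 0)"
  proof -
    have "{1..n + 1} = Suc ` {..n}" by (simp add: atMost_atLeast0 image_Suc_atLeastAtMost)
    then show ?thesis by (auto simp: edges_def)
  qed
  finally show ?thesis using lookup_boundary2[OF z] by (simp add: c_def)
qed

lemma parameters_imp_H2:
  assumes z: "z \<in> free_on (faces n)" and d: "cycle_parameters n z s w"
  shows "z \<in> H2 n"
  unfolding H2_iff[OF z]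
proof (intro conjI ballI allI impI)
  let ?c = "Poly_Mapping.lookup z"
  fix k assume k: "k \<in> {1..n}"
  then have c: "?c (FB1 k) = - (gr_x - 1) * s k"
    "?c (FB2 k) = (gr_x - 1) * ((1 + gr_x) * s k - gr_x * w k - (gr_x - 1) * (\<Sum>i=1..<k. w i))"
    "?c (FB3 k) = (gr_x - 1) * (w k - s k)"
    "(\<Sum>i=1..<k. ?c (FA i k)) = column_sum s w k"
    "(\<Sum>j\<in>{k<..n}. ?c (FA k j)) = column_sum s w k + (gr_y - 1) * w k"
    using d by (auto simp: cycle_parameters_def balanced_def)
  show "(gr_x - 1) * (\<Sum>i=1..<k. ?c (FA i k)) + (1 - gr_y) * ?c (FB1 k) - gr_y * ?c (FB2 k) = 0"
    unfolding c column_sum_def by (simp add: algebra_simps)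
  show "- (gr_x - 1) * (\<Sum>j\<in>{k<..n}. ?c (FA k j)) + gr_y * ?c (FB2 k) + (gr_y - 1) * ?c (FB3 k) = 0"
    unfolding c column_sum_def by (simp add: algebra_simps)
next
  let ?c = "Poly_Mapping.lookup z"
  let ?W = "\<lambda>k. \<Sum>i=1..<k. w i"
  fix k assume k: "k \<le> n"
  note out = lookup_outside_faces[OF z]
  have W: "?W (Suc n) = 0"
    using d by (simp add: cycle_parameters_def balanced_def atLeastLessThanSuc_atLeastAtMost)
  \<comment> \<open>Both contributions at the edge \<open>c\<^bsub>k+1\<^esub>\<close> are the same multiple of \<open>\<Sum>\<^bsub>i\<le>k\<^esub> w\<^sub>i\<close>.\<close>
  have "gr_x * ?c (FB1 k) + ?c (FB2 k) + ?c (FB3 k) = - (gr_x - 1) * (gr_x - 1) * ?W (Suc k)"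
  proof (cases "k = 0")
    case False
    then have Wk: "?W (Suc k) = ?W k + w k" by simp
    have c: "?c (FB1 k) = - (gr_x - 1) * s k"
      "?c (FB2 k) = (gr_x - 1) * ((1 + gr_x) * s k - gr_x * w k - (gr_x - 1) * ?W k)"
      "?c (FB3 k) = (gr_x - 1) * (w k - s k)"
      using d False k by (auto simp: cycle_parameters_def)
    show ?thesis unfolding c Wk by (simp add: algebra_simps)
  qed (use out in simp)
  moreover have "?c (FB1 (Suc k)) + ?c (FB2 (Suc k)) + gr_x * ?c (FB3 (Suc k))
      = - (gr_x - 1) * (gr_x - 1) * ?W (Suc k)"
  proof (cases "k = n")
    case False
    then have c: "?c (FB1 (Suc k)) = - (gr_x - 1) * s (Suc k)"
      "?c (FB2 (Suc k)) = (gr_x - 1) * ((1 + gr_x) * s (Suc k) - gr_x * w (Suc k)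
        - (gr_x - 1) * ?W (Suc k))"
      "?c (FB3 (Suc k)) = (gr_x - 1) * (w (Suc k) - s (Suc k))"
      using d k by (auto simp: cycle_parameters_def)
    show ?thesis unfolding c by (simp add: algebra_simps)
  qed (use out W in simp)
  ultimately show "gr_x * ?c (FB1 k) + ?c (FB2 k) + ?c (FB3 k)
      - (?c (FB1 (Suc k)) + ?c (FB2 (Suc k)) + gr_x * ?c (FB3 (Suc k))) = 0" by simp
qed

text \<open>
  The divisions by \<open>x - 1\<close> that define \<open>w\<close> and \<open>s\<close> are possible because \<open>y - 1\<close> and \<open>1 + xy\<close> can be
  cancelled modulo \<open>x - 1\<close>.
\<close>

lemma H2_has_parameters:
  assumes "z \<in> H2 n"
  shows "\<exists>s w. cycle_parameters n z s w"
proof -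
  let ?c = "Poly_Mapping.lookup z"
  define p where "p k = ?c (FB1 k)" for k
  define q where "q k = ?c (FB2 k)" for k
  define r where "r k = ?c (FB3 k)" for k
  define S where "S k = (\<Sum>i=1..<k. ?c (FA i k))" for k
  define T where "T k = (\<Sum>j\<in>{k<..n}. ?c (FA k j))" for k
  have z: "z \<in> free_on (faces n)" using assms by (simp add: H2_def)
  note out = lookup_outside_faces[OF z, folded p_def q_def r_def]
  have a: "(gr_x - 1) * S k + (1 - gr_y) * p k - gr_y * q k = 0"
    and b: "- (gr_x - 1) * T k + gr_y * q k + (gr_y - 1) * r k = 0" if "k \<in> {1..n}" for k
    using assms that unfolding H2_iff[OF z] p_def q_def r_def S_def T_def by blast+
  have c: "p (Suc k) + q (Suc k) + gr_x * r (Suc k) = gr_x * p k + q k + r k"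
    if "k \<le> n" for k
    using assms that unfolding H2_iff[OF z] p_def q_def r_def by (metis right_minus_eq)
  have "\<exists>w. r k - p k = (gr_x - 1) * w" if k: "k \<in> {1..n}" for k
  proof -
    have "(gr_y - 1) * (r k - p k) = (gr_x - 1) * (T k - S k)
        + ((gr_x - 1) * S k + (1 - gr_y) * p k - gr_y * q k)
        + (- (gr_x - 1) * T k + gr_y * q k + (gr_y - 1) * r k)"
      by (simp add: algebra_simps)
    then have "gr_x - 1 dvd (gr_y - 1) * (r k - p k)"
      by (simp only: a[OF k] b[OF k] add_0_right dvd_triv_left)
    then show ?thesis by (blast dest: x_minus_1_dvd_cancel_y_minus_1)
  qed
  then obtain w where w: "r k - p k = (gr_x - 1) * w k" if "k \<in> {1..n}" for k
    by metis
  let ?W = "\<lambda>k. \<Sum>i=1..<k. w i"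
  \<comment> \<open>The recursion along the edges \<open>c\<^sub>k\<close>, starting with the empty sum at \<open>c\<^sub>1\<close>.\<close>
  have u: "p (Suc k) + q (Suc k) + gr_x * r (Suc k) = - (gr_x - 1) * (gr_x - 1) * ?W (Suc k)"
    if "k \<le> n" for k
    using that
  proof (induction k)
    case 0
    show ?case unfolding c[OF le0] by (simp add: out[of 0])
  next
    case (Suc k)
    have "p (Suc (Suc k)) + q (Suc (Suc k)) + gr_x * r (Suc (Suc k))
        = gr_x * p (Suc k) + q (Suc k) + r (Suc k)"
      by (rule c[OF Suc.prems])
    also have "\<dots> = (p (Suc k) + q (Suc k) + gr_x * r (Suc k)) - (gr_x - 1) * (r (Suc k) - p (Suc k))"
      by (simp add: algebra_simps)
    also have "\<dots> = - (gr_x - 1) * (gr_x - 1) * ?W (Suc k) - (gr_x - 1) * ((gr_x - 1) * w (Suc k))"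
      using Suc w[of "Suc k"] by simp
    also have "\<dots> = - (gr_x - 1) * (gr_x - 1) * ?W (Suc (Suc k))"
      by (simp add: algebra_simps)
    finally show ?case .
  qed
  \<comment> \<open>At \<open>c\<^bsub>n+1\<^esub>\<close> the left-hand side of \<open>u\<close> is zero.\<close>
  have "(gr_x - 1) * ((gr_x - 1) * ?W (Suc n)) = 0"
  proof -
    have "(gr_x - 1) * ((gr_x - 1) * ?W (Suc n)) = - (- (gr_x - 1) * (gr_x - 1) * ?W (Suc n))"
      by (simp only: mult_minus_left minus_minus mult.assoc)
    also have "\<dots> = 0" unfolding u[OF order_refl, symmetric] by (simp add: out[of "Suc n"])
    finally show ?thesis .
  qed
  then have W: "(\<Sum>i=1..n. w i) = 0"
    using x_minus_1_regular by (metis atLeastLessThanSuc_atLeastAtMost)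
  have u': "p k + q k + gr_x * r k = - (gr_x - 1) * (gr_x - 1) * ?W k" if "k \<in> {1..n}" for k
    using u[of "k - 1"] that by (cases k) simp_all
  have "\<exists>s. p k = (gr_x - 1) * s" if k: "k \<in> {1..n}" for k
  proof -
    have "(1 + gr_x * gr_y) * p k = gr_y * (p k + q k + gr_x * r k) - (gr_x - 1) * S k
        - gr_x * gr_y * (r k - p k) + ((gr_x - 1) * S k + (1 - gr_y) * p k - gr_y * q k)"
      by (simp add: algebra_simps)
    also have "\<dots> = (gr_x - 1) *
        (- gr_y * ((gr_x - 1) * ?W k) - S k - gr_x * gr_y * w k)"
      unfolding u'[OF k] w[OF k] a[OF k] by (simp add: algebra_simps)
    finally have "gr_x - 1 dvd (1 + gr_x * gr_y) * p k" by simp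
    then show ?thesis by (blast dest: x_minus_1_dvd_cancel_xy_plus_1)
  qed
  then obtain s' where s': "p k = (gr_x - 1) * s' k" if "k \<in> {1..n}" for k
    by metis
  define s where "s k = - s' k" for k
  have s: "p k = - (gr_x - 1) * s k" if "k \<in> {1..n}" for k
    using s'[OF that] by (simp add: s_def algebra_simps)
  have r: "r k = (gr_x - 1) * (w k - s k)" if k: "k \<in> {1..n}" for k
  proof -
    have "r k = (r k - p k) + p k" by simp
    also have "\<dots> = (gr_x - 1) * (w k - s k)"
      unfolding w[OF k] unfolding s[OF k] by (simp add: algebra_simps)
    finally show ?thesis .
  qed
  have q: "q k = (gr_x - 1) * ((1 + gr_x) * s k - gr_x * w k - (gr_x - 1) * ?W k)"
    if k: "k \<in> {1..n}" for k
  proof -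
    have "q k = (p k + q k + gr_x * r k) - p k - gr_x * r k" by simp
    also have "\<dots> = (gr_x - 1) * ((1 + gr_x) * s k - gr_x * w k - (gr_x - 1) * ?W k)"
      unfolding u'[OF k] unfolding s[OF k] r[OF k] by (simp add: algebra_simps)
    finally show ?thesis .
  qed
  have S: "S k = column_sum s w k" if k: "k \<in> {1..n}" for k
  proof -
    have "(gr_x - 1) * S k = (gr_x - 1) * column_sum s w k
        + ((gr_x - 1) * S k + (1 - gr_y) * p k - gr_y * q k)"
      unfolding q[OF k] s[OF k] column_sum_def by (simp add: algebra_simps)
    then show ?thesis by (simp add: a[OF k] x_minus_1_cancel)
  qed
  have T: "T k = column_sum s w k + (gr_y - 1) * w k" if k: "k \<in> {1..n}" for k
  proof -
    have "(gr_x - 1) * T k = (gr_x - 1) * (column_sum s w k + (gr_y - 1) * w k)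
        - (- (gr_x - 1) * T k + gr_y * q k + (gr_y - 1) * r k)"
      unfolding q[OF k] r[OF k] column_sum_def by (simp add: algebra_simps)
    then show ?thesis unfolding b[OF k] diff_0_right x_minus_1_cancel .
  qed
  have "cycle_parameters n z s w"
    unfolding cycle_parameters_def balanced_def using W S T s q r
    by (simp add: p_def q_def r_def S_def T_def)
  then show ?thesis by blast
qed

section \<open>Triangular arrays with prescribed row and column sums\<close>

lemma column_sum_first: "column_sum s w 1 = (1 + gr_x * gr_y) * s 1 - gr_x * gr_y * w 1"
  by (simp add: column_sum_def)

lemma row_sum_last:
  assumes "n \<ge> 1" "(\<Sum>i=1..n. w i) = 0"
  shows "column_sum s w n + (gr_y - 1) * w n = (1 + gr_x * gr_y) * s n - w n"
proof -
  obtain m where n: "n = Suc m" using assms(1) by (cases n) auto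
  have "(\<Sum>i=1..<n. w i) + w n = 0"
    using assms(2) by (simp add: n atLeastLessThanSuc_atLeastAtMost)
  then have W: "(\<Sum>i=1..<n. w i) = - w n" by (simp add: eq_neg_iff_add_eq_0)
  show ?thesis unfolding column_sum_def W by (simp add: algebra_simps)
qed

lemma sum_split_last:
  fixes f :: "nat \<Rightarrow> 'm::comm_monoid_add"
  assumes "a < n"
  shows "(\<Sum>j\<in>{a<..n}. f j) = (\<Sum>j\<in>{a<..<n}. f j) + f n"
proof -
  have "{a<..n} = insert n {a<..<n}" using assms by auto
  then show ?thesis by (simp add: add.commute)
qed

lemma sum_split_first:
  fixes f :: "nat \<Rightarrow> 'm::comm_monoid_add"
  assumes "1 < k"
  shows "(\<Sum>i=1..<k. f i) = f 1 + (\<Sum>i=2..<k. f i)"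
  using assms by (subst sum.atLeast_Suc_lessThan) (simp_all add: numeral_2_eq_2)

text \<open>
  The entries of \<open>a'\<close> inside the triangle are kept. Every column but the last is corrected in the
  first row, and every row but the last in the last column. The sum of the last column is then correct because the
  prescribed row sums and the prescribed column sums have the same total, by \<open>\<Sum> w\<^sub>i = 0\<close>. The assumptions
  \<open>first\<close> and \<open>last\<close> say that the prescribed sums over the empty column and the empty row are zero.
\<close>

lemma balanced_extension:
  assumes "n \<ge> 2" and W: "(\<Sum>i=1..n. w i) = 0"
    and first: "(1 + gr_x * gr_y) * s 1 = gr_x * gr_y * w 1"
    and last: "w n = (1 + gr_x * gr_y) * s n"
  shows "\<exists>a. balanced n s w a \<and> (\<forall>i\<ge>2. \<forall>j<n. a i j = a' i j)"
proof -
  define C where "C = column_sum s w"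
  define D where "D k = C k + (gr_y - 1) * w k" for k
  have C1: "C 1 = 0" unfolding C_def column_sum_first first by simp
  have Dn: "D n = 0"
    using row_sum_last[of n w s] assms by (simp add: D_def C_def)
  define a1 where "a1 j = C j - (\<Sum>i=2..<j. a' i j)" for j
  define a where "a i j = (if i = 1 then if j < n then a1 j else D 1 - (\<Sum>j\<in>{1<..<n}. a1 j)
      else if j < n then a' i j else D i - (\<Sum>j\<in>{i<..<n}. a' i j))" for i j
  have row: "(\<Sum>j\<in>{k<..n}. a k j) = D k" if "k \<in> {1..n}" for k
  proof (cases "k = n")
    case False
    then show ?thesis using that by (subst sum_split_last) (auto simp: a_def)
  qed (simp add: Dn)
  have col: "(\<Sum>i=1..<k. a i k) = C k" if "k \<in> {1..<n}" for k
  proof (cases "k = 1")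
    case False
    then show ?thesis using that by (subst sum_split_first) (auto simp: a_def a1_def)
  qed (use C1 in simp)
  have "(\<Sum>k=1..n. \<Sum>i=1..<k. a i k) = (\<Sum>k=1..n. D k)"
    unfolding sum_columns_eq_sum_rows by (intro sum.cong refl row)
  also have "\<dots> = (\<Sum>k=1..n. C k)"
    using W by (simp add: D_def sum.distrib sum_distrib_left[symmetric])
  finally have total: "(\<Sum>k=1..n. \<Sum>i=1..<k. a i k) = (\<Sum>k=1..n. C k)" .
  have split: "(\<Sum>k=1..n. f k) = (\<Sum>k=1..<n. f k) + f n" for f :: "nat \<Rightarrow> group_ring"
    using assms(1) by (cases n) (simp_all add: atLeastLessThanSuc_atLeastAtMost)
  have "(\<Sum>k=1..<n. \<Sum>i=1..<k. a i k) = (\<Sum>k=1..<n. C k)"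
    by (intro sum.cong refl col)
  with total have "(\<Sum>i=1..<n. a i n) = C n" unfolding split by (simp only: add_left_cancel)
  with col have col: "(\<Sum>i=1..<k. a i k) = C k" if "k \<in> {1..n}" for k
    using that by (cases "k = n") auto
  have "balanced n s w a"
    unfolding balanced_def using W row col by (simp add: C_def D_def)
  moreover have "\<forall>i\<ge>2. \<forall>j<n. a i j = a' i j" by (simp add: a_def)
  ultimately show ?thesis by blast
qed

lemma balanced_zero:
  assumes "n \<ge> 1" and bal: "balanced n s w a"
    and s0: "\<And>k. k \<in> {1..n} \<Longrightarrow> s k = 0"
    and w0: "\<And>k. k \<in> {1..n} \<Longrightarrow> w k = 0"
    and a0: "\<And>i j. 2 \<le> i \<Longrightarrow> i < j \<Longrightarrow> j < n \<Longrightarrow> a i j = 0"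
    and ij: "1 \<le> i" "i < j" "j \<le> n"
  shows "a i j = 0"
proof -
  have C: "column_sum s w k = 0" if "k \<in> {1..n}" for k
    using that by (simp add: column_sum_def s0 w0)
  have col: "(\<Sum>i=1..<k. a i k) = 0" and row: "(\<Sum>j\<in>{k<..n}. a k j) = 0" if "k \<in> {1..n}" for k
    using bal C[OF that] w0[OF that] that by (auto simp: balanced_def)
  have first: "a 1 k = 0" if "1 < k" "k < n" for k
    using col[of k] that sum_split_first[of k "\<lambda>i. a i k"] by (simp add: a0)
  have inner: "a k l = 0" if "1 \<le> k" "k < l" "l < n" for k l
    using that first[of l] a0[of k l] by (cases "k = 1") auto
  show ?thesis
  proof (cases "j = n")
    case True
    then show ?thesis
      using row[of i] ij sum_split_last[of i n "a i"] by (simp add: inner)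
  qed (use inner ij in simp)
qed

section \<open>Coordinates on the cycles\<close>

lemma cycle_exists:
  assumes "balanced n s w a"
  shows "\<exists>z\<in>H2 n. cycle_parameters n z s w \<and>
    (\<forall>i j. 1 \<le> i \<longrightarrow> i < j \<longrightarrow> j \<le> n \<longrightarrow> Poly_Mapping.lookup z (FA i j) = a i j)"
proof -
  define f where "f e = (case e of FA i j \<Rightarrow> a i j
    | FB1 k \<Rightarrow> - (gr_x - 1) * s k
    | FB2 k \<Rightarrow> (gr_x - 1) * ((1 + gr_x) * s k - gr_x * w k - (gr_x - 1) * (\<Sum>i=1..<k. w i))
    | FB3 k \<Rightarrow> (gr_x - 1) * (w k - s k))" for e
  define z where "z = (\<Sum>e\<in>faces n. Poly_Mapping.single e (f e))"
  have coeff: "Poly_Mapping.lookup z e = (if e \<in> faces n then f e else 0)" for e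
    using finite_faces[of n] by (simp add: z_def lookup_sum lookup_single when_def)
  have z: "z \<in> free_on (faces n)" by (simp add: free_on_iff coeff)
  have a: "Poly_Mapping.lookup z (FA i j) = a i j" if "1 \<le> i" "i < j" "j \<le> n" for i j
    using that by (auto simp: coeff faces_def f_def)
  have "FB1 k \<in> faces n \<and> FB2 k \<in> faces n \<and> FB3 k \<in> faces n" if "k \<in> {1..n}" for k
    using that by (auto simp: faces_def)
  moreover have "balanced n s w (\<lambda>i j. Poly_Mapping.lookup z (FA i j))"
    using assms by (simp add: balanced_def a cong: sum.cong_simp)
  ultimately have "cycle_parameters n z s w" by (simp add: cycle_parameters_def coeff f_def)
  with a parameters_imp_H2[OF z] show ?thesis by blast
qed

text \<open>
  A cycle is described by its parameters \<open>s\<^sub>k\<close> and \<open>w\<^sub>k\<close> and its coefficients at the cells \<open>A\<^sub>i\<^sub>j\<close>.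
\<close>

datatype coordinate = CS nat | CW nat | CA nat nat

fun coordinate_value :: "coordinate \<Rightarrow> (face \<Rightarrow>\<^sub>0 group_ring) \<Rightarrow> group_ring" where
  "coordinate_value (CS k) z = quotient_x_minus_1 (- Poly_Mapping.lookup z (FB1 k))"
| "coordinate_value (CW k) z =
     quotient_x_minus_1 (Poly_Mapping.lookup z (FB3 k) - Poly_Mapping.lookup z (FB1 k))"
| "coordinate_value (CA i j) z = Poly_Mapping.lookup z (FA i j)"

lemma cycle_parameters_coordinates:
  assumes "cycle_parameters n z s w" "k \<in> {1..n}"
  shows "coordinate_value (CS k) z = s k" "coordinate_value (CW k) z = w k"
proof -
  have p: "- Poly_Mapping.lookup z (FB1 k) = (gr_x - 1) * s k"
    and r: "Poly_Mapping.lookup z (FB3 k) - Poly_Mapping.lookup z (FB1 k) = (gr_x - 1) * w k"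
  proof -
    have c: "Poly_Mapping.lookup z (FB1 k) = - (gr_x - 1) * s k"
      "Poly_Mapping.lookup z (FB3 k) = (gr_x - 1) * (w k - s k)"
      using assms by (auto simp: cycle_parameters_def)
    show "- Poly_Mapping.lookup z (FB1 k) = (gr_x - 1) * s k"
      "Poly_Mapping.lookup z (FB3 k) - Poly_Mapping.lookup z (FB1 k) = (gr_x - 1) * w k"
      unfolding c by (simp_all add: algebra_simps)
  qed
  show "coordinate_value (CS k) z = s k" "coordinate_value (CW k) z = w k"
    by (simp_all only: coordinate_value.simps p r quotient_x_minus_1_mult)
qed

lemma quotient_x_minus_1_add:
  assumes "gr_x - 1 dvd f" "gr_x - 1 dvd g"
  shows "quotient_x_minus_1 (f + g) = quotient_x_minus_1 f + quotient_x_minus_1 g"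
  using assms by (auto elim!: dvdE simp flip: distrib_left)

lemma quotient_x_minus_1_scale:
  assumes "gr_x - 1 dvd f"
  shows "quotient_x_minus_1 (c * f) = c * quotient_x_minus_1 f"
  using assms by (auto elim!: dvdE simp: mult.left_commute[of c])

lemma H2_x_minus_1_dvd:
  assumes "z \<in> H2 n" "k \<in> {1..n}"
  shows "gr_x - 1 dvd - Poly_Mapping.lookup z (FB1 k)"
    "gr_x - 1 dvd Poly_Mapping.lookup z (FB3 k) - Poly_Mapping.lookup z (FB1 k)"
proof -
  obtain s w where "cycle_parameters n z s w" using H2_has_parameters assms(1) by blast
  then have "Poly_Mapping.lookup z (FB1 k) = (gr_x - 1) * (- s k)"
    "Poly_Mapping.lookup z (FB3 k) = (gr_x - 1) * (w k - s k)"
    using assms(2) by (simp_all add: cycle_parameters_def algebra_simps)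
  then show "gr_x - 1 dvd - Poly_Mapping.lookup z (FB1 k)"
    "gr_x - 1 dvd Poly_Mapping.lookup z (FB3 k) - Poly_Mapping.lookup z (FB1 k)"
    by (simp_all only: dvd_minus_iff dvd_diff dvd_triv_left)
qed

text \<open>
  The indices for which a cycle has parameters, so that the divisions in \<open>coordinate_value\<close> are exact.
\<close>

definition in_range :: "nat \<Rightarrow> coordinate \<Rightarrow> bool" where
  "in_range n i \<longleftrightarrow> (case i of CS k \<Rightarrow> k \<in> {1..n} | CW k \<Rightarrow> k \<in> {1..n} | CA _ _ \<Rightarrow> True)"

lemma coordinate_value_add:
  assumes "u \<in> H2 n" "v \<in> H2 n" "in_range n i"
  shows "coordinate_value i (u + v) = coordinate_value i u + coordinate_value i v"
proof (cases i)
  case (CS k)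
  with assms have "k \<in> {1..n}" by (simp add: in_range_def)
  from quotient_x_minus_1_add[OF H2_x_minus_1_dvd(1)[OF assms(1) this] H2_x_minus_1_dvd(1)[OF assms(2) this]] CS
  show ?thesis by (simp add: lookup_add)
next
  case (CW k)
  with assms have "k \<in> {1..n}" by (simp add: in_range_def)
  from quotient_x_minus_1_add[OF H2_x_minus_1_dvd(2)[OF assms(1) this] H2_x_minus_1_dvd(2)[OF assms(2) this]] CW
  show ?thesis by (simp add: lookup_add algebra_simps)
qed (simp add: lookup_add)

lemma coordinate_value_scale:
  assumes "v \<in> H2 n" "in_range n i"
  shows "coordinate_value i (smul c v) = c * coordinate_value i v"
proof (cases i)
  case (CS k)
  with assms have "k \<in> {1..n}" by (simp add: in_range_def)
  from quotient_x_minus_1_scale[OF H2_x_minus_1_dvd(1)[OF assms(1) this], of c] CS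
  show ?thesis by simp
next
  case (CW k)
  with assms have "k \<in> {1..n}" by (simp add: in_range_def)
  from quotient_x_minus_1_scale[OF H2_x_minus_1_dvd(2)[OF assms(1) this], of c] CW
  show ?thesis by (simp add: right_diff_distrib)
qed simp

text \<open>
  This moves the problem from cycles to the parameters: a set of coordinates is a system of free
  coordinates if the parameters \<open>s\<close> and \<open>w\<close> in it determine the others and can be chosen at will, and
  its entries of the array are those inside the triangle.
\<close>

lemma H2_free_by_coordinates:
  assumes "n \<ge> 1" "finite I" "\<And>i. i \<in> I \<Longrightarrow> in_range n i"
    and determined: "\<And>s w a k. balanced n s w a \<Longrightarrow>
      (\<And>k. CS k \<in> I \<Longrightarrow> s k = 0) \<Longrightarrow> (\<And>k. CW k \<in> I \<Longrightarrow> w k = 0) \<Longrightarrow> k \<in> {1..n} \<Longrightarrow>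
      s k = 0 \<and> w k = 0"
    and inner: "\<And>i j. CA i j \<in> I \<longleftrightarrow> 2 \<le> i \<and> i < j \<and> j < n"
    and extend: "\<And>s w a. \<exists>s' w' a'. balanced n s' w' a' \<and> (\<forall>k. CS k \<in> I \<longrightarrow> s' k = s k) \<and>
      (\<forall>k. CW k \<in> I \<longrightarrow> w' k = w k) \<and> (\<forall>i j. CA i j \<in> I \<longrightarrow> a' i j = a i j)"
  shows "chain.free_of_rank (H2 n) (card I)"
proof (rule chain.free_of_rank_coordinates[where \<xi> = coordinate_value])
  fix z assume z: "z \<in> H2 n" and 0: "\<And>i. i \<in> I \<Longrightarrow> coordinate_value i z = 0"
  let ?a = "\<lambda>i j. Poly_Mapping.lookup z (FA i j)"
  from z obtain s w where sw: "cycle_parameters n z s w" using H2_has_parameters by blast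
  then have bal: "balanced n s w ?a" by (simp add: cycle_parameters_def)
  have "s k = 0" if "CS k \<in> I" for k
    using 0[OF that] assms(3)[OF that] cycle_parameters_coordinates(1)[OF sw, of k]
    by (simp add: in_range_def)
  moreover have "w k = 0" if "CW k \<in> I" for k
    using 0[OF that] assms(3)[OF that] cycle_parameters_coordinates(2)[OF sw, of k]
    by (simp add: in_range_def)
  ultimately have sw0: "s k = 0 \<and> w k = 0" if "k \<in> {1..n}" for k
    using determined[OF bal _ _ that] by blast
  have a0: "?a i j = 0" if "1 \<le> i" "i < j" "j \<le> n" for i j
    using assms(1) bal
  proof (rule balanced_zero)
    show "?a k l = 0" if "2 \<le> k" "k < l" "l < n" for k l
      using 0[of "CA k l"] inner that by simp
  qed (use that sw0 in blast)+
  have "Poly_Mapping.lookup z (FB1 k) = 0 \<and> Poly_Mapping.lookup z (FB2 k) = 0 \<and>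
      Poly_Mapping.lookup z (FB3 k) = 0" if "k \<in> {1..n}" for k
    using sw sw0 that by (simp add: cycle_parameters_def)
  then have "Poly_Mapping.lookup z e = 0" if "e \<in> faces n" for e
    using a0 that by (auto simp: faces_def)
  moreover have "z \<in> free_on (faces n)" using z by (simp add: H2_def)
  ultimately have "Poly_Mapping.lookup z e = 0" for e
    by (cases "e \<in> faces n") (auto simp: free_on_iff)
  then show "z = 0" by (intro poly_mapping_eqI) (simp only: lookup_zero)
next
  fix c :: "coordinate \<Rightarrow> group_ring"
  from extend[of "\<lambda>k. c (CS k)" "\<lambda>k. c (CW k)" "\<lambda>i j. c (CA i j)"]
  obtain s w a where bal: "balanced n s w a" and c: "\<And>k. CS k \<in> I \<Longrightarrow> s k = c (CS k)"
    "\<And>k. CW k \<in> I \<Longrightarrow> w k = c (CW k)" "\<And>i j. CA i j \<in> I \<Longrightarrow> a i j = c (CA i j)"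
    by blast
  from cycle_exists[OF bal] obtain z where z: "z \<in> H2 n" "cycle_parameters n z s w"
    "\<And>i j. 1 \<le> i \<Longrightarrow> i < j \<Longrightarrow> j \<le> n \<Longrightarrow> Poly_Mapping.lookup z (FA i j) = a i j"
    by blast
  have "coordinate_value i z = c i" if "i \<in> I" for i
  proof (cases i)
    case (CS k)
    with that assms(3)[OF that] cycle_parameters_coordinates(1)[OF z(2), of k] c(1)
    show ?thesis by (simp add: in_range_def)
  next
    case (CW k)
    with that assms(3)[OF that] cycle_parameters_coordinates(2)[OF z(2), of k] c(2)
    show ?thesis by (simp add: in_range_def)
  next
    case (CA k l)
    with that inner z(3)[of k l] c(3) show ?thesis by simp
  qed
  with z(1) show "\<exists>z\<in>H2 n. \<forall>i\<in>I. coordinate_value i z = c i" by blast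
next
  show "coordinate_value i (u + v) = coordinate_value i u + coordinate_value i v"
    if "i \<in> I" "u \<in> H2 n" "v \<in> H2 n" for i u v
    using that(2,3) assms(3)[OF that(1)] by (rule coordinate_value_add)
  show "coordinate_value i (smul c v) = c * coordinate_value i v"
    if "i \<in> I" "v \<in> H2 n" for i c v
    using that(2) assms(3)[OF that(1)] by (rule coordinate_value_scale)
qed (rule assms(2) subspace_H2)+

lemma gr_xy_inverse: "gr_x * gr_y * gr (- 1, - 1) = 1"
  by (simp add: gr_x_def gr_y_def mult_single zero_prod_def[symmetric])

lemma balanced_ends:
  assumes "n \<ge> 1" "balanced n s w a"
  shows "(1 + gr_x * gr_y) * s 1 = gr_x * gr_y * w 1" "w n = (1 + gr_x * gr_y) * s n"
proof -
  have "column_sum s w 1 = 0" "column_sum s w n + (gr_y - 1) * w n = 0"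
    and W: "(\<Sum>i=1..n. w i) = 0"
    using assms by (force simp: balanced_def)+
  then show "(1 + gr_x * gr_y) * s 1 = gr_x * gr_y * w 1" "w n = (1 + gr_x * gr_y) * s n"
    unfolding column_sum_first row_sum_last[OF assms(1) W] by simp_all
qed

section \<open>The rank\<close>

lemma H2_rank_1: "chain.free_of_rank (H2 1) (card ({} :: coordinate set))"
proof (rule H2_free_by_coordinates)
  fix s w a k assume bal: "balanced 1 s w a" and k: "k \<in> {1..1::nat}"
  from bal have w: "w 1 = 0" by (simp add: balanced_def)
  with balanced_ends(2)[OF _ bal] have "s 1 = 0" using xy_plus_1_regular by simp
  with w k show "s k = 0 \<and> w k = 0" by simp
next
  show "\<exists>s' w' a'. balanced 1 s' w' a' \<and> (\<forall>k. CS k \<in> {} \<longrightarrow> s' k = s k) \<and>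
      (\<forall>k. CW k \<in> {} \<longrightarrow> w' k = w k) \<and> (\<forall>i j. CA i j \<in> {} \<longrightarrow> a' i j = a i j)" for s w a
    by (rule exI[of _ "\<lambda>_. 0"], rule exI[of _ "\<lambda>_. 0"]) (simp add: balanced_def column_sum_def)
qed auto

text \<open>
  As \<open>xy\<close> is a unit, \<open>s\<^sub>1\<close> can serve as the free parameter that determines \<open>w\<^sub>1\<close>.
\<close>

lemma first_balance_iff:
  "(1 + gr_x * gr_y) * s = gr_x * gr_y * w \<longleftrightarrow> w = (1 + gr (- 1, - 1)) * s"
proof -
  have "(1 + u) * s = u * w \<longleftrightarrow> w = (1 + e) * s" if "u * e = 1" for u e :: group_ring
  proof
    assume *: "(1 + u) * s = u * w"
    have "w = (u * e) * w" unfolding that by simp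
    also have "\<dots> = e * (u * w)" by (simp only: mult_ac)
    also have "\<dots> = e * s + (u * e) * s" unfolding *[symmetric] by (simp add: algebra_simps)
    finally show "w = (1 + e) * s" unfolding that by (simp add: algebra_simps)
  next
    assume w: "w = (1 + e) * s"
    have "u * w = u * s + (u * e) * s" unfolding w by (simp add: algebra_simps)
    then show "(1 + u) * s = u * w" unfolding that by (simp add: algebra_simps)
  qed
  then show ?thesis using gr_xy_inverse by blast
qed

text \<open>
  Both \<open>w\<^sub>1 = (1 + (xy)\<^sup>-\<^sup>1) s\<^sub>1\<close> and \<open>w\<^sub>2 = (1 + xy) s\<^sub>2\<close> are multiples of \<open>1 + xy\<close>, so \<open>w\<^sub>1 + w\<^sub>2 = 0\<close> is
  solved by \<open>s\<^sub>2 = - (xy)\<^sup>-\<^sup>1 s\<^sub>1\<close>.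
\<close>

lemma H2_rank_2: "chain.free_of_rank (H2 2) (card {CS 1})"
proof (rule H2_free_by_coordinates)
  fix s w a k assume bal: "balanced 2 s w a" and s: "\<And>k. CS k \<in> {CS 1} \<Longrightarrow> s k = 0"
    and k: "k \<in> {1..2::nat}"
  have w1: "w 1 = 0"
    using balanced_ends(1)[OF _ bal] s unfolding first_balance_iff by simp
  then have w2: "w 2 = 0" using bal by (simp add: balanced_def numeral_2_eq_2)
  then have "s 2 = 0" using balanced_ends(2)[OF _ bal] xy_plus_1_regular by simp
  with w1 w2 s k show "s k = 0 \<and> w k = 0" by (cases "k = 1") (auto simp: le_Suc_eq numeral_2_eq_2)
next
  fix s w :: "nat \<Rightarrow> group_ring" and a :: "nat \<Rightarrow> nat \<Rightarrow> group_ring"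
  let ?e = "gr (- 1, - 1)"
  define s' where "s' k = (if k = 1 then s 1 else - ?e * s 1)" for k :: nat
  define w' where "w' k = (if k = 1 then (1 + ?e) * s 1 else - (1 + ?e) * s 1)" for k :: nat
  have "\<exists>b. balanced 2 s' w' b \<and> (\<forall>i\<ge>2. \<forall>j<2. b i j = a i j)"
  proof (rule balanced_extension)
    show "(\<Sum>i=1..2. w' i) = 0" by (simp add: w'_def numeral_2_eq_2 algebra_simps)
    show "(1 + gr_x * gr_y) * s' 1 = gr_x * gr_y * w' 1"
      unfolding first_balance_iff by (simp add: s'_def w'_def)
    have s2: "(1 + gr_x * gr_y) * s' 2 = - ?e * s 1 - (gr_x * gr_y * ?e) * s 1"
      by (simp add: s'_def algebra_simps)
    show "w' 2 = (1 + gr_x * gr_y) * s' 2"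
      unfolding s2 gr_xy_inverse by (simp add: w'_def algebra_simps)
  qed simp
  then obtain b where "balanced 2 s' w' b" by blast
  then show "\<exists>s' w' a'. balanced 2 s' w' a' \<and> (\<forall>k. CS k \<in> {CS 1} \<longrightarrow> s' k = s k) \<and>
      (\<forall>k. CW k \<in> {CS 1} \<longrightarrow> w' k = w k) \<and> (\<forall>i j. CA i j \<in> {CS 1} \<longrightarrow> a' i j = a i j)"
    by (intro exI[of _ s'] exI[of _ w'] exI[of _ b]) (simp add: s'_def)
qed (auto simp: in_range_def)

text \<open>
  A system of free coordinates for \<open>n \<ge> 3\<close>.
\<close>

definition coordinates :: "nat \<Rightarrow> coordinate set" where
  "coordinates n = CS ` {1..n} \<union> CW ` {2..n - 2} \<union>
     (\<lambda>(j, i). CA i j) ` (SIGMA j:{2..<n}. {2..<j})"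

lemma sum_ends:
  fixes f :: "nat \<Rightarrow> 'm::comm_monoid_add"
  assumes "n \<ge> 3"
  shows "(\<Sum>k=1..n. f k) = f 1 + (\<Sum>k=2..n - 2. f k) + f (n - 1) + f n"
proof -
  have "{1..n} = insert 1 (insert (n - 1) (insert n {2..n - 2}))" using assms by auto
  moreover have "1 \<notin> insert (n - 1) (insert n {2..n - 2})" "n - 1 \<notin> insert n {2..n - 2}"
    "n \<notin> {2..n - 2}"
    using assms by auto
  ultimately show ?thesis by (simp add: add_ac del: One_nat_def)
qed

text \<open>
  Since \<open>n - 1\<close> differs from \<open>1\<close> and \<open>n\<close>, the parameter \<open>w\<^bsub>n-1\<^esub>\<close> is there to solve \<open>\<Sum> w\<^sub>i = 0\<close>.
\<close>

lemma H2_rank_ge_3: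
  assumes n: "n \<ge> 3"
  shows "chain.free_of_rank (H2 n) (card (coordinates n))"
proof (rule H2_free_by_coordinates)
  fix s w a k assume bal: "balanced n s w a"
    and s: "\<And>k. CS k \<in> coordinates n \<Longrightarrow> s k = 0"
    and w: "\<And>k. CW k \<in> coordinates n \<Longrightarrow> w k = 0" and k: "k \<in> {1..n}"
  have s0: "s k = 0" if "k \<in> {1..n}" for k using s that by (auto simp: coordinates_def)
  have w0: "w k = 0" if "k \<in> {2..n - 2}" for k using w that by (auto simp: coordinates_def)
  have w1: "w 1 = 0"
    using balanced_ends(1)[OF _ bal] s0[of 1] n unfolding first_balance_iff by simp
  have wn: "w n = 0" using balanced_ends(2)[OF _ bal] s0[of n] n by simp
  have "(\<Sum>k=1..n. w k) = 0" using bal by (simp add: balanced_def)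
  then have "w (n - 1) = 0" unfolding sum_ends[OF n] using w0 w1 wn by simp
  moreover have "k = 1 \<or> k \<in> {2..n - 2} \<or> k = n - 1 \<or> k = n" using k by auto
  ultimately show "s k = 0 \<and> w k = 0" using s0[OF k] w0 w1 wn by blast
next
  fix s w :: "nat \<Rightarrow> group_ring" and a :: "nat \<Rightarrow> nat \<Rightarrow> group_ring"
  let ?w1 = "(1 + gr (- 1, - 1)) * s 1" and ?wn = "(1 + gr_x * gr_y) * s n"
  define w' where "w' k = (if k = 1 then ?w1 else if k = n then ?wn
    else if k = n - 1 then - (?w1 + ?wn + (\<Sum>k=2..n - 2. w k)) else w k)" for k
  have w': "w' k = w k" if "k \<in> {2..n - 2}" for k using that n by (auto simp: w'_def)
  have "\<exists>b. balanced n s w' b \<and> (\<forall>i\<ge>2. \<forall>j<n. b i j = a i j)"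
  proof (rule balanced_extension)
    have "(\<Sum>k=2..n - 2. w' k) = (\<Sum>k=2..n - 2. w k)" by (intro sum.cong refl w')
    moreover have "w' 1 = ?w1" "w' n = ?wn"
      "w' (n - 1) = - (?w1 + ?wn + (\<Sum>k=2..n - 2. w k))"
      using n by (auto simp: w'_def)
    ultimately show "(\<Sum>k=1..n. w' k) = 0"
      unfolding sum_ends[OF n] by (simp only:) simp
    show "(1 + gr_x * gr_y) * s 1 = gr_x * gr_y * w' 1"
      unfolding first_balance_iff by (simp add: w'_def)
    show "w' n = (1 + gr_x * gr_y) * s n" using n by (simp add: w'_def)
  qed (use n in simp)
  then obtain b where "balanced n s w' b" "\<forall>i\<ge>2. \<forall>j<n. b i j = a i j" by blast
  moreover have "w' k = w k" if "CW k \<in> coordinates n" for k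
    using w' that by (auto simp: coordinates_def)
  ultimately show "\<exists>s' w' a'. balanced n s' w' a' \<and>
      (\<forall>k. CS k \<in> coordinates n \<longrightarrow> s' k = s k) \<and> (\<forall>k. CW k \<in> coordinates n \<longrightarrow> w' k = w k) \<and>
      (\<forall>i j. CA i j \<in> coordinates n \<longrightarrow> a' i j = a i j)"
    by (intro exI[of _ s] exI[of _ w'] exI[of _ b]) (auto simp: coordinates_def)
qed (use n in \<open>auto simp: coordinates_def in_range_def\<close>)

lemma card_coordinates:
  assumes "n \<ge> 3"
  shows "card (coordinates n) = n * (n - 1) div 2"
proof -
  obtain m where m: "n = m + 3" using assms by (metis add.commute le_Suc_ex)
  let ?P = "SIGMA j:{2..<n}. {2..<j}"
  have "card ?P = (\<Sum>j=2..<m + 3. j - 2)" by (simp add: m)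
  also have "\<dots> = m * (m + 1) div 2"
  proof (induction m)
    case (Suc m)
    have "{2..<Suc m + 3} = insert (m + 3) {2..<m + 3}" by auto
    then show ?case using Suc by simp
  qed simp
  finally have P: "card ((\<lambda>(j, i). CA i j) ` ?P) = m * (m + 1) div 2"
    by (subst card_image) (auto simp: inj_on_def)
  have "card (CS ` {1..n} \<union> CW ` {2..n - 2}) = n + m"
    by (subst card_Un_disjoint) (auto simp: card_image inj_on_def m)
  then have "card (coordinates n) = n + m + m * (m + 1) div 2"
    unfolding coordinates_def using P by (subst card_Un_disjoint) auto
  also have "\<dots> = (2 * (n + m) + m * (m + 1)) div 2" by simp
  also have "2 * (n + m) + m * (m + 1) = n * (n - 1)" by (simp add: m algebra_simps)
  finally show ?thesis .
qed

theorem proposition3p6: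
  fixes n :: nat
  assumes "n \<ge> 1"
  shows "chain.free_of_rank (H2 n) (n * (n - 1) div 2)"
proof -
  consider "n = 1" | "n = 2" | "n \<ge> 3" using assms by linarith
  then show ?thesis
  proof cases
    case 1
    then show ?thesis using H2_rank_1 by simp
  next
    case 2
    then show ?thesis using H2_rank_2 by simp
  next
    case 3
    then show ?thesis using H2_rank_ge_3 card_coordinates by metis
  qed
qed

end
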